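(* Let $n\ge1$. For all positive integers $m_1,\ldots,m_n$: (1) The circle group action on the quantum sphere $S^{2n+1}_q$ that defines the quantum weighted projective space $\mathbb{WP}^n_q(1,m_1,\ldots,m_n)$ is free; that is, the $\mathbb{Z}$-grading of $\mathcal{O}(S^{2n+1}_q)$ given by $|z_0|=1$, $|z_i|=m_i$, $|z_0^*|=-1$, $|z_i^*|=-m_i$ ($i=1,\ldots,n$) is strong. (2) The circle group action on the quantum prolongated sphere $\Sigma^{2n+1}_q$ that defines the quantum real weighted projective space $\mathbb{RP}^{2n}_q(1,m_1,\ldots,m_n)$ is free; that is, the $\mathbb{Z}$-grading of $\mathcal{O}(\Sigma^{2n+1}_q)$ given by $|z_0|=1$, $|z_i|=m_i$, $|z_0^*|=-1$, $|z_i^*|=-m_i$ ($i=1,\ldots,n$), $|w|=-2m_n$, is strong.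
   Context: Fix a real number $q\in(0,1)$. The algebra $\mathcal{O}(S^{2n+1}_q)$ is the unital complex $*$-algebra generated by $z_0,\ldots,z_n$ subject to the relations $$z_iz_j=qz_jz_i\ (i<j),\qquad z_iz_j^*=qz_j^*z_i\ (i\ne j),$$ $$z_iz_i^*=z_i^*z_i+(q^{-2}-1)\sum_{j=i+1}^n z_jz_j^*,\qquad \sum_{j=0}^n z_jz_j^*=1.$$ The algebra $\mathcal{O}(\Sigma^{2n+1}_q)$ is the unital complex $*$-algebra generated by $z_0,\ldots,z_n$ and a central unitary $w$, subject to the same relations together with $z_n^*=wz_n$. For positive integers $\mathbf{m}=(m_0,\ldots,m_n)$, both algebras are $\mathbb{Z}$-graded by $|z_i|=m_i$, $|z_i^*|=-m_i$ (hence $|w|=-2m_n$); such a grading is equivalent to a circle action (a $\mathbb{C}[u,u^*]$-coaction $z_i\mapsto z_i\otimes u^{m_i}$). The degree-zero part of $\mathcal{O}(S^{2n+1}_q)$ is $\mathcal{O}(\mathbb{WP}^n_q(\mathbf{m}))$ and the degree-zero part of $\mathcal{O}(\Sigma^{2n+1}_q)$ is $\mathcal{O}(\mathbb{RP}^{2n}_q(\mathbf{m}))$; the corresponding circle actions are the defining actions of these spaces. In the noncommutative setting, a circle action is called free if the corresponding $\mathbb{Z}$-grading is strong: $\mathcal{A}=\bigoplus_{k\in\mathbb{Z}}\mathcal{A}_k$ is strongly graded if $\mathcal{A}_k\mathcal{A}_l=\mathcal{A}_{k+l}$ for all $k,l\in\mathbb{Z}$ (linear span of products). *)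

theory Defs
  imports
    Complex_Main
    "HOL-Library.Poly_Mapping"
    "HOL-Algebra.Module"
    "HOL-Algebra.QuotRing"
begin

section \<open>Unital complex *-algebras given by generators and relations\<close>

record 'a star_algebra = "(complex, 'a) module" +
  star :: "'a \<Rightarrow> 'a"

definition complex_field :: "complex ring" where
  "complex_field = \<lparr>carrier = UNIV, mult = (*), one = 1, zero = 0, add = (+)\<rparr>"

text \<open>
  \<open>Gen x\<close> stands for the generator \<open>x\<close> and \<open>Adj x\<close> for \<open>x\<^sup>*\<close>. Words in these letters form
  a monoid under concatenation; it is written additively so that \<open>'g word \<Rightarrow>\<^sub>0 complex\<close>,
  with the convolution product of \<^theory>\<open>HOL-Library.Poly_Mapping\<close>, is the
  free unital complex algebra on the letters.
\<close>

datatype 'g letter = Gen 'g | Adj 'g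

datatype 'g word = Word (letters: "'g letter list")

instantiation word :: (type) monoid_add
begin

definition zero_word :: "'a word" where
  "0 = Word []"

definition plus_word :: "'a word \<Rightarrow> 'a word \<Rightarrow> 'a word" where
  "u + v = Word (letters u @ letters v)"

instance
  by standard (simp_all add: zero_word_def plus_word_def)

end

type_synonym 'g star_poly = "'g word \<Rightarrow>\<^sub>0 complex"

definition scalar :: "complex \<Rightarrow> 'g star_poly" where
  "scalar c = Poly_Mapping.single 0 c"

definition gen :: "'g \<Rightarrow> 'g star_poly" where
  "gen x = Poly_Mapping.single (Word [Gen x]) 1"

definition adj :: "'g \<Rightarrow> 'g star_poly" where
  "adj x = Poly_Mapping.single (Word [Adj x]) 1"

fun star_letter :: "'g letter \<Rightarrow> 'g letter" where
  "star_letter (Gen x) = Adj x"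
| "star_letter (Adj x) = Gen x"

definition star_word :: "'g word \<Rightarrow> 'g word" where
  "star_word u = Word (rev (map star_letter (letters u)))"

definition star_poly :: "'g star_poly \<Rightarrow> 'g star_poly" where
  "star_poly p = (\<Sum>u\<in>Poly_Mapping.keys p.
     Poly_Mapping.single (star_word u) (cnj (Poly_Mapping.lookup p u)))"

definition words_over :: "'g set \<Rightarrow> 'g word set" where
  "words_over X = {u. set (letters u) \<subseteq> Gen ` X \<union> Adj ` X}"

definition free_star_algebra :: "'g set \<Rightarrow> 'g star_poly star_algebra" where
  "free_star_algebra X =
    \<lparr>carrier = {p. Poly_Mapping.keys p \<subseteq> words_over X},
     mult = (*), one = 1, zero = 0, add = (+),
     smult = (\<lambda>c p. scalar c * p),
     star = star_poly\<rparr>"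

text \<open>
  An element \<open>r\<close> of \<open>R\<close> encodes the relation \<open>r = 0\<close>. In a *-algebra \<open>r = 0\<close> also forces
  \<open>r\<^sup>* = 0\<close>, so the two-sided ideal to be factored out is generated by \<open>R\<close> and its adjoints.
\<close>

definition relation_ideal :: "'g set \<Rightarrow> 'g star_poly set \<Rightarrow> 'g star_poly set" where
  "relation_ideal X R = Idl\<^bsub>free_star_algebra X\<^esub> (R \<union> star_poly ` R)"

definition presented_star_algebra ::
    "'g set \<Rightarrow> 'g star_poly set \<Rightarrow> 'g star_poly set star_algebra" where
  "presented_star_algebra X R =
    (let F = free_star_algebra X; I = relation_ideal X R; Q = F Quot I in
     \<lparr>carrier = carrier Q, mult = mult Q, one = one Q, zero = zero Q, add = add Q,
      smult = (\<lambda>c C. \<Union>p\<in>C. I +>\<^bsub>F\<^esub> (c \<odot>\<^bsub>F\<^esub> p)),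
      star = (\<lambda>C. \<Union>p\<in>C. I +>\<^bsub>F\<^esub> star F p)\<rparr>)"

text \<open>\<open>relation_ideal\<close> is an intersection of ideals; the family is nonempty by the following.\<close>

lemma zero_in_words_over [simp]: "0 \<in> words_over X"
  by (simp add: words_over_def zero_word_def)

lemma plus_in_words_over [simp]:
  "u \<in> words_over X \<Longrightarrow> v \<in> words_over X \<Longrightarrow> u + v \<in> words_over X"
  by (auto simp: words_over_def plus_word_def)

lemma ring_free_star_algebra: "ring (free_star_algebra X)"
proof (rule ringI)
  show "abelian_group (free_star_algebra X)"
  proof (rule abelian_groupI)
    fix p assume "p \<in> carrier (free_star_algebra X)"
    then have "- p \<in> carrier (free_star_algebra X) \<and>
        - p \<oplus>\<^bsub>free_star_algebra X\<^esub> p = \<zero>\<^bsub>free_star_algebra X\<^esub>"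
      by (simp add: free_star_algebra_def)
    then show "\<exists>r\<in>carrier (free_star_algebra X).
        r \<oplus>\<^bsub>free_star_algebra X\<^esub> p = \<zero>\<^bsub>free_star_algebra X\<^esub>" by blast
  next
    fix p r assume "p \<in> carrier (free_star_algebra X)" "r \<in> carrier (free_star_algebra X)"
    then show "p \<oplus>\<^bsub>free_star_algebra X\<^esub> r \<in> carrier (free_star_algebra X)"
      using Poly_Mapping.keys_add[of p r] by (auto simp: free_star_algebra_def)
  qed (simp_all add: free_star_algebra_def ac_simps)
  show "Group.monoid (free_star_algebra X)"
  proof (rule monoidI)
    fix p r assume "p \<in> carrier (free_star_algebra X)" "r \<in> carrier (free_star_algebra X)"
    then show "p \<otimes>\<^bsub>free_star_algebra X\<^esub> r \<in> carrier (free_star_algebra X)"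
      using keys_mult[of p r] by (fastforce simp: free_star_algebra_def)
  qed (simp_all add: free_star_algebra_def mult.assoc)
qed (simp_all add: free_star_algebra_def algebra_simps)


section \<open>Strong gradings\<close>

definition graded_algebra ::
    "('a, 'b) star_algebra_scheme \<Rightarrow> (int \<Rightarrow> 'a set) \<Rightarrow> bool" where
  "graded_algebra A G \<longleftrightarrow>
     (\<forall>k. submodule (G k) complex_field A) \<and>
     (\<forall>a\<in>carrier A. \<exists>!f. (\<forall>k. f k \<in> G k) \<and> finite {k. f k \<noteq> \<zero>\<^bsub>A\<^esub>} \<and>
        a = (\<Oplus>\<^bsub>A\<^esub>k\<in>{k. f k \<noteq> \<zero>\<^bsub>A\<^esub>}. f k)) \<and>
     (\<forall>k l. G k <#>\<^bsub>A\<^esub> G l \<subseteq> G (k + l))"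

definition lin_span :: "('a, 'b) star_algebra_scheme \<Rightarrow> 'a set \<Rightarrow> 'a set" where
  "lin_span A S = (\<lambda>V. submodule V complex_field A) hull S"

definition strongly_graded ::
    "('a, 'b) star_algebra_scheme \<Rightarrow> (int \<Rightarrow> 'a set) \<Rightarrow> bool" where
  "strongly_graded A G \<longleftrightarrow>
     graded_algebra A G \<and> (\<forall>k l. lin_span A (G k <#>\<^bsub>A\<^esub> G l) = G (k + l))"

fun letter_degree :: "('g \<Rightarrow> int) \<Rightarrow> 'g letter \<Rightarrow> int" where
  "letter_degree d (Gen x) = d x"
| "letter_degree d (Adj x) = - d x"

definition word_degree :: "('g \<Rightarrow> int) \<Rightarrow> 'g word \<Rightarrow> int" where
  "word_degree d u = (\<Sum>l\<leftarrow>letters u. letter_degree d l)"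

text \<open>The classes of linear combinations of words of degree \<open>k\<close>, where \<open>|x| = d x\<close>:\<close>

definition degree_part ::
    "'g set \<Rightarrow> 'g star_poly set \<Rightarrow> ('g \<Rightarrow> int) \<Rightarrow> int \<Rightarrow> 'g star_poly set set" where
  "degree_part X R d k =
     (\<lambda>p. relation_ideal X R +>\<^bsub>free_star_algebra X\<^esub> p) `
       {p \<in> carrier (free_star_algebra X). \<forall>u\<in>Poly_Mapping.keys p. word_degree d u = k}"


section \<open>The quantum spheres and the quantum prolongated spheres\<close>

datatype generator = Z nat | W

abbreviation z :: "nat \<Rightarrow> generator star_poly" where "z i \<equiv> gen (Z i)"
abbreviation zs :: "nat \<Rightarrow> generator star_poly" where "zs i \<equiv> adj (Z i)"
abbreviation w :: "generator star_poly" where "w \<equiv> gen W"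
abbreviation ws :: "generator star_poly" where "ws \<equiv> adj W"

definition sphere_gens :: "nat \<Rightarrow> generator set" where
  "sphere_gens n = Z ` {..n}"

definition sphere_rels :: "real \<Rightarrow> nat \<Rightarrow> generator star_poly set" where
  "sphere_rels q n =
     {z i * z j - scalar (of_real q) * (z j * z i) | i j. i < j \<and> j \<le> n} \<union>
     {z i * zs j - scalar (of_real q) * (zs j * z i) | i j. i \<le> n \<and> j \<le> n \<and> i \<noteq> j} \<union>
     {z i * zs i - (zs i * z i + scalar (of_real (1 / q\<^sup>2 - 1)) * (\<Sum>j=i+1..n. z j * zs j)) | i.
        i \<le> n} \<union>
     {(\<Sum>j=0..n. z j * zs j) - 1}"

definition prolongated_gens :: "nat \<Rightarrow> generator set" where
  "prolongated_gens n = insert W (sphere_gens n)"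

definition prolongated_rels :: "real \<Rightarrow> nat \<Rightarrow> generator star_poly set" where
  "prolongated_rels q n =
     sphere_rels q n \<union>
     {w * z i - z i * w | i. i \<le> n} \<union>
     {w * zs i - zs i * w | i. i \<le> n} \<union>
     {w * ws - 1, ws * w - 1} \<union>
     {zs n - w * z n}"

fun gen_degree :: "nat \<Rightarrow> (nat \<Rightarrow> nat) \<Rightarrow> generator \<Rightarrow> int" where
  "gen_degree n m (Z i) = int (m i)"
| "gen_degree n m W = - 2 * int (m n)"

definition quantum_sphere :: "real \<Rightarrow> nat \<Rightarrow> generator star_poly set star_algebra" where
  "quantum_sphere q n = presented_star_algebra (sphere_gens n) (sphere_rels q n)"

definition quantum_sphere_grading ::
    "real \<Rightarrow> nat \<Rightarrow> (nat \<Rightarrow> nat) \<Rightarrow> int \<Rightarrow> generator star_poly set set" where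
  "quantum_sphere_grading q n m =
     degree_part (sphere_gens n) (sphere_rels q n) (gen_degree n m)"

definition prolongated_sphere :: "real \<Rightarrow> nat \<Rightarrow> generator star_poly set star_algebra" where
  "prolongated_sphere q n = presented_star_algebra (prolongated_gens n) (prolongated_rels q n)"

definition prolongated_sphere_grading ::
    "real \<Rightarrow> nat \<Rightarrow> (nat \<Rightarrow> nat) \<Rightarrow> int \<Rightarrow> generator star_poly set set" where
  "prolongated_sphere_grading q n m =
     degree_part (prolongated_gens n) (prolongated_rels q n) (gen_degree n m)"

text \<open>The weight vector \<open>(1, m\<^sub>1, \<dots>, m\<^sub>n)\<close>; only the entries \<open>0, \<dots>, n\<close> matter.\<close>

definition unit_weights :: "(nat \<Rightarrow> nat) \<Rightarrow> nat \<Rightarrow> nat" where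
  "unit_weights m = m(0 := 1)"

end

(*
  If the relations are homogeneous, the ideal they generate is homogeneous, so the quotient is
  graded, and it is strongly graded as soon as 1 lies in A_1 A_{-1} and in A_{-1} A_1.
  Write J for one of these two products, an ideal of A_0, and let a = z_0, b = z_0^* (or the
  other way round). The sphere relations give b a = (1 - c) + c a b with c = q^{-2} (or q^2), hence
  b a^{N+1} = (1 - c^{N+1}) a^N + c^{N+1} a^{N+1} b.  As c is not a root of unity and a b \<in> J,
  for x of degree 0 it follows that x b^N a^N \<in> J implies x \<in> J. For j \<ge> 1 take N = m_j - 1: up to
  a power of q, z_j z_j^* b^N a^N is (z_j b^N) (z_j^* a^N) \<in> J, so z_j z_j^* \<in> J (or z_j^* z_j \<in> J,
  from which z_j z_j^* \<in> J by descending induction on j). Since z_0 z_0^* + ... + z_n z_n^* = 1,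
  this gives 1 \<in> J.
*)

theory Submission
  imports Defs
begin

section \<open>Homogeneous elements of the free algebra\<close>

text \<open>Reduces claims that are linear in \<open>p\<close> to monomials, where
  \<open>mult_single\<close> decides them.\<close>

lemma star_poly_mapping_eq_sum_single:
  "p = (\<Sum>u\<in>Poly_Mapping.keys p. Poly_Mapping.single u (Poly_Mapping.lookup p u))"
  by (rule poly_mapping_eqI)
    (auto simp: lookup_sum lookup_single when_def in_keys_iff sum.delta)

lemma scalar_single: "scalar c * Poly_Mapping.single u b = Poly_Mapping.single u (c * b)"
  by (simp add: scalar_def mult_single)

lemma single_scalar: "Poly_Mapping.single u b * scalar c = Poly_Mapping.single u (c * b)"
  by (simp add: scalar_def mult_single mult.commute)

text \<open>A scalar sits on the empty word, the unit of concatenation, so it is central although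
  the free algebra is not commutative.\<close>

lemma scalar_commute: "p * scalar c = scalar c * p"
proof -
  \<comment> \<open>The expansion of \<open>p\<close> contains \<open>p\<close> again, so rewriting
    \<open>p\<close> with it would loop; the claim is proved for the expanded sum and folded
    back.\<close>
  let ?s = "\<Sum>u\<in>Poly_Mapping.keys p. Poly_Mapping.single u (Poly_Mapping.lookup p u)"
  have "?s * scalar c = scalar c * ?s"
    by (simp only: sum_distrib_left sum_distrib_right scalar_single single_scalar)
  then show ?thesis
    by (simp only: star_poly_mapping_eq_sum_single[symmetric])
qed

lemma scalar_left_commute: "p * (scalar c * r) = scalar c * (p * r)"
  by (metis mult.assoc scalar_commute)

lemma scalar_scalar: "scalar c * (scalar b * p) = scalar (c * b) * p"
  by (simp add: scalar_def mult_single flip: mult.assoc)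

lemma scalar_1 [simp]: "scalar 1 = 1"
  by (simp add: scalar_def)

lemma scalar_diff: "scalar (c - b) = scalar c - scalar b"
  by (simp add: scalar_def single_diff)

lemma scalar_uminus: "scalar (- c) = - scalar c"
  by (simp add: scalar_def single_uminus)

lemma scalar_mult: "scalar (c * b) = scalar c * scalar b"
  by (simp add: scalar_def mult_single)

lemma word_degree_0 [simp]: "word_degree d 0 = 0"
  by (simp add: word_degree_def zero_word_def)

lemma word_degree_add [simp]: "word_degree d (u + v) = word_degree d u + word_degree d v"
  by (simp add: word_degree_def plus_word_def)

lemma word_degree_star_word [simp]: "word_degree d (star_word u) = - word_degree d u"
proof -
  have "letter_degree d (star_letter l) = - letter_degree d l" for l
    by (cases l) auto
  then have "sum_list (map (letter_degree d) (map star_letter ls)) =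
      - sum_list (map (letter_degree d) ls)" for ls
    by (induction ls) auto
  then show ?thesis
    by (simp add: word_degree_def star_word_def flip: rev_map)
qed

lemma star_word_in_words_over [simp]: "u \<in> words_over X \<Longrightarrow> star_word u \<in> words_over X"
proof -
  have "star_letter l \<in> Gen ` X \<union> Adj ` X" if "l \<in> Gen ` X \<union> Adj ` X" for l
    using that by (cases l) auto
  then show "star_word u \<in> words_over X" if "u \<in> words_over X"
    using that by (auto simp: words_over_def star_word_def subset_iff)
qed

lemma keys_star_poly: "Poly_Mapping.keys (star_poly p) \<subseteq> star_word ` Poly_Mapping.keys p"
  unfolding star_poly_def
  by (rule order.trans[OF keys_sum]) auto

section \<open>Homogeneous subspaces and their closure properties\<close>

definition hom_polys :: "'g set \<Rightarrow> ('g \<Rightarrow> int) \<Rightarrow> int \<Rightarrow> 'g star_poly set" where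
  "hom_polys X d k =
     {p. Poly_Mapping.keys p \<subseteq> words_over X \<and> (\<forall>u\<in>Poly_Mapping.keys p. word_degree d u = k)}"

lemma hom_polys_0 [simp]: "0 \<in> hom_polys X d k"
  by (simp add: hom_polys_def)

lemma hom_polys_scalar [simp]: "scalar c \<in> hom_polys X d 0"
  by (simp add: hom_polys_def scalar_def)

lemma hom_polys_1 [simp]: "1 \<in> hom_polys X d 0"
  by (simp add: hom_polys_def)

lemma hom_polys_add: "p \<in> hom_polys X d k \<Longrightarrow> r \<in> hom_polys X d k \<Longrightarrow> p + r \<in> hom_polys X d k"
  using Poly_Mapping.keys_add[of p r] by (auto simp: hom_polys_def)

lemma hom_polys_uminus: "p \<in> hom_polys X d k \<Longrightarrow> - p \<in> hom_polys X d k"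
  by (simp add: hom_polys_def)

lemma hom_polys_diff: "p \<in> hom_polys X d k \<Longrightarrow> r \<in> hom_polys X d k \<Longrightarrow> p - r \<in> hom_polys X d k"
  using hom_polys_add[OF _ hom_polys_uminus, of p X d k r] by simp

lemma hom_polys_mult:
  "p \<in> hom_polys X d k \<Longrightarrow> r \<in> hom_polys X d l \<Longrightarrow> p * r \<in> hom_polys X d (k + l)"
  using keys_mult[of p r] by (fastforce simp: hom_polys_def)

lemma hom_polys_scalar_mult: "p \<in> hom_polys X d k \<Longrightarrow> scalar c * p \<in> hom_polys X d k"
  using hom_polys_mult[OF hom_polys_scalar] by fastforce

lemma hom_polys_power: "p \<in> hom_polys X d k \<Longrightarrow> p ^ j \<in> hom_polys X d (int j * k)"
proof (induction j)
  case (Suc j)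
  then show ?case
    using hom_polys_mult[of p X d k "p ^ j" "int j * k"] by (simp add: algebra_simps)
qed simp

lemma hom_polys_sum:
  "(\<And>j. j \<in> S \<Longrightarrow> f j \<in> hom_polys X d k) \<Longrightarrow> (\<Sum>j\<in>S. f j) \<in> hom_polys X d k"
  by (induction S rule: infinite_finite_induct) (auto intro: hom_polys_add)

lemma hom_polys_gen: "x \<in> X \<Longrightarrow> gen x \<in> hom_polys X d (d x)"
  by (simp add: hom_polys_def gen_def words_over_def word_degree_def)

lemma hom_polys_adj: "x \<in> X \<Longrightarrow> adj x \<in> hom_polys X d (- d x)"
  by (simp add: hom_polys_def adj_def words_over_def word_degree_def)

lemma hom_polys_star: "p \<in> hom_polys X d k \<Longrightarrow> star_poly p \<in> hom_polys X d (- k)"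
  using keys_star_poly[of p] by (fastforce simp: hom_polys_def)

section \<open>Homogeneous components\<close>

lift_definition hom_part :: "('g \<Rightarrow> int) \<Rightarrow> int \<Rightarrow> 'g star_poly \<Rightarrow> 'g star_poly"
  is "\<lambda>d k p u. p u when word_degree d u = k"
  by (rule rev_finite_subset) auto

lemma hom_part_0 [simp]: "hom_part d k 0 = 0"
  by transfer (simp add: fun_eq_iff)

lemma hom_part_add: "hom_part d k (p + r) = hom_part d k p + hom_part d k r"
  by transfer (simp add: fun_eq_iff when_def)

lemma hom_part_uminus: "hom_part d k (- p) = - hom_part d k p"
  by transfer (simp add: fun_eq_iff when_def)

lemma hom_part_diff: "hom_part d k (p - r) = hom_part d k p - hom_part d k r"
  by transfer (simp add: fun_eq_iff when_def)

lemma hom_part_sum: "hom_part d k (\<Sum>j\<in>S. f j) = (\<Sum>j\<in>S. hom_part d k (f j))"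
  by (induction S rule: infinite_finite_induct) (auto simp: hom_part_add)

lemma hom_part_single:
  "hom_part d k (Poly_Mapping.single u c) = (if word_degree d u = k then Poly_Mapping.single u c else 0)"
  by transfer (auto simp: fun_eq_iff when_def)

lemma keys_hom_part: "Poly_Mapping.keys (hom_part d k p) = {u \<in> Poly_Mapping.keys p. word_degree d u = k}"
  by transfer (auto simp: when_def)

lemma hom_part_in_hom_polys:
  "Poly_Mapping.keys p \<subseteq> words_over X \<Longrightarrow> hom_part d k p \<in> hom_polys X d k"
  by (auto simp: hom_polys_def keys_hom_part)

lemma hom_part_hom_polys:
  assumes "p \<in> hom_polys X d l"
  shows "hom_part d k p = (if k = l then p else 0)"
  using assms unfolding hom_polys_def
  by (auto intro!: poly_mapping_eqI simp: hom_part.rep_eq when_def in_keys_iff)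

text \<open>Degrees of words add up, so multiplication by a monomial shifts every component by the
  same amount. A general factor would mix degrees, hence the restriction to
  \<open>single u c\<close>.\<close>

lemma hom_part_single_mult:
  "hom_part d k (Poly_Mapping.single u c * p) =
     Poly_Mapping.single u c * hom_part d (k - word_degree d u) p"
proof -
  let ?s = "\<Sum>v\<in>Poly_Mapping.keys p. Poly_Mapping.single v (Poly_Mapping.lookup p v)"
  have "hom_part d k (Poly_Mapping.single u c * ?s) =
     Poly_Mapping.single u c * hom_part d (k - word_degree d u) ?s"
    unfolding sum_distrib_left hom_part_sum
    by (rule sum.cong) (auto simp: mult_single hom_part_single)
  then show ?thesis
    by (simp only: star_poly_mapping_eq_sum_single[symmetric])
qed

lemma hom_part_mult_single:
  "hom_part d k (p * Poly_Mapping.single u c) =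
     hom_part d (k - word_degree d u) p * Poly_Mapping.single u c"
proof -
  let ?s = "\<Sum>v\<in>Poly_Mapping.keys p. Poly_Mapping.single v (Poly_Mapping.lookup p v)"
  have "hom_part d k (?s * Poly_Mapping.single u c) =
     hom_part d (k - word_degree d u) ?s * Poly_Mapping.single u c"
    unfolding sum_distrib_right hom_part_sum
    by (rule sum.cong) (auto simp: mult_single hom_part_single)
  then show ?thesis
    by (simp only: star_poly_mapping_eq_sum_single[symmetric])
qed

lemma hom_part_decomposition:
  assumes "finite K" and "word_degree d ` Poly_Mapping.keys p \<subseteq> K"
  shows "p = (\<Sum>k\<in>K. hom_part d k p)"
proof (rule poly_mapping_eqI)
  fix u
  have "(\<Sum>k\<in>K. Poly_Mapping.lookup p u when word_degree d u = k) = Poly_Mapping.lookup p u"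
    using assms by (cases "u \<in> Poly_Mapping.keys p") (auto simp: when_def in_keys_iff)
  then show "Poly_Mapping.lookup p u = Poly_Mapping.lookup (\<Sum>k\<in>K. hom_part d k p) u"
    by (simp add: lookup_sum hom_part.rep_eq)
qed

section \<open>Presentations by homogeneous relations\<close>

text \<open>\<open>R\<close> may mix degrees, but each single relation is homogeneous. Its adjoint
  is then homogeneous of the opposite degree, so all generators of the ideal are
  homogeneous.\<close>

locale graded_presentation =
  fixes X :: "'g set" and R :: "'g star_poly set" and d :: "'g \<Rightarrow> int"
  assumes rels_homogeneous: "R \<subseteq> (\<Union>k. hom_polys X d k)"
begin

abbreviation F :: "'g star_poly star_algebra" where "F \<equiv> free_star_algebra X"
abbreviation I :: "'g star_poly set" where "I \<equiv> relation_ideal X R"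
abbreviation A :: "'g star_poly set star_algebra" where "A \<equiv> presented_star_algebra X R"
abbreviation G :: "int \<Rightarrow> 'g star_poly set set" where "G \<equiv> degree_part X R d"
abbreviation H :: "int \<Rightarrow> 'g star_poly set" where "H \<equiv> hom_polys X d"

text \<open>The canonical projection of the free algebra onto the quotient.\<close>

definition cls :: "'g star_poly \<Rightarrow> 'g star_poly set" where
  "cls p = I +>\<^bsub>F\<^esub> p"

lemma carrier_F: "carrier F = {p. Poly_Mapping.keys p \<subseteq> words_over X}"
  by (simp add: free_star_algebra_def)

lemma F_simps [simp]:
  "mult F = (*)" "zero F = 0" "add F = (+)" "smult F = (\<lambda>c p. scalar c * p)"
  by (simp_all add: free_star_algebra_def)

lemma hom_in_F: "p \<in> H k \<Longrightarrow> p \<in> carrier F"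
  by (simp add: hom_polys_def carrier_F)

lemma zero_in_F [simp]: "0 \<in> carrier F"
  by (simp add: carrier_F)

lemma F_closed:
  assumes "p \<in> carrier F" "r \<in> carrier F"
  shows "p + r \<in> carrier F" "p * r \<in> carrier F"
  using assms Poly_Mapping.keys_add[of p r] keys_mult[of p r] unfolding carrier_F by fastforce+

lemma F_uminus: "p \<in> carrier F \<Longrightarrow> - p \<in> carrier F"
  by (simp add: carrier_F)

lemma relations_in_F: "R \<union> star_poly ` R \<subseteq> carrier F"
  using rels_homogeneous hom_in_F hom_polys_star[of _ X d] by fast

lemma ideal_I: "ideal I F"
  unfolding relation_ideal_def
  by (rule ring.genideal_ideal[OF ring_free_star_algebra relations_in_F])

text \<open>Links the record-level inverse of \<open>F\<close> with the type-class minus, in which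
  later calculations are written.\<close>

lemma a_inv_F: "p \<in> carrier F \<Longrightarrow> \<ominus>\<^bsub>F\<^esub> p = - p"
proof -
  interpret ring F by (rule ring_free_star_algebra)
  assume "p \<in> carrier F"
  then show ?thesis
    using F_uminus[of p] by (intro minus_equality) auto
qed

lemma I_0: "0 \<in> I"
  using additive_subgroup.zero_closed[OF ideal.axioms(1)[OF ideal_I]] by simp

lemma I_in_F: "p \<in> I \<Longrightarrow> p \<in> carrier F"
  using ideal.Icarr[OF ideal_I] .

lemma I_add: "p \<in> I \<Longrightarrow> r \<in> I \<Longrightarrow> p + r \<in> I"
  using additive_subgroup.a_closed[OF ideal.axioms(1)[OF ideal_I]] by simp

lemma I_uminus: "p \<in> I \<Longrightarrow> - p \<in> I"
  using additive_subgroup.a_inv_closed[OF ideal.axioms(1)[OF ideal_I]] a_inv_F I_in_F by metis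

lemma I_diff: "p \<in> I \<Longrightarrow> r \<in> I \<Longrightarrow> p - r \<in> I"
  using I_add[OF _ I_uminus] by fastforce

lemma I_mult_left: "p \<in> I \<Longrightarrow> r \<in> carrier F \<Longrightarrow> r * p \<in> I"
  using ideal.I_l_closed[OF ideal_I] by simp

lemma I_mult_right: "p \<in> I \<Longrightarrow> r \<in> carrier F \<Longrightarrow> p * r \<in> I"
  using ideal.I_r_closed[OF ideal_I] by simp

lemma I_scalar: "p \<in> I \<Longrightarrow> scalar c * p \<in> I"
  by (rule I_mult_left[OF _ hom_in_F[OF hom_polys_scalar]])

lemma I_sum: "(\<And>j. j \<in> S \<Longrightarrow> f j \<in> I) \<Longrightarrow> (\<Sum>j\<in>S. f j) \<in> I"
  by (induction S rule: infinite_finite_induct) (auto intro: I_add I_0)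

lemma rel_in_I: "r \<in> R \<Longrightarrow> r \<in> I"
  unfolding relation_ideal_def genideal_def by blast

lemma star_rel_in_I: "r \<in> R \<Longrightarrow> star_poly r \<in> I"
  unfolding relation_ideal_def genideal_def by blast

lemma hom_part_in_F: "p \<in> carrier F \<Longrightarrow> hom_part d k p \<in> carrier F"
  by (auto simp: carrier_F keys_hom_part)

text \<open>The ideal is homogeneous: the polynomials all of whose components lie in
  \<open>I\<close> form an ideal \<open>J\<close>. It contains the relations and their adjoints,
  each of which has at most one nonzero component, so minimality gives
  \<open>I \<subseteq> J\<close>.\<close>

lemma hom_part_I:
  assumes "p \<in> I"
  shows "hom_part d k p \<in> I"
proof -
  define J where "J = {p \<in> carrier F. \<forall>k. hom_part d k p \<in> I}"
  have single_F: "Poly_Mapping.single u c \<in> carrier F" if "a \<in> carrier F" "u \<in> Poly_Mapping.keys a"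
    for a u c using that by (auto simp: carrier_F)
  \<comment> \<open>With \<open>x\<close> expanded into monomials, each component of the product is
    a sum of monomials times shifted components of \<open>a\<close>, and these lie in
    \<open>I\<close>.\<close>
  have left: "x * a \<in> J" and right: "a * x \<in> J" if a: "a \<in> J" and x: "x \<in> carrier F" for a x
  proof -
    have aF: "a \<in> carrier F" and ak: "\<And>k. hom_part d k a \<in> I"
      using a by (auto simp: J_def)
    let ?s = "\<lambda>u. Poly_Mapping.single u (Poly_Mapping.lookup x u)"
    have "hom_part d k (\<Sum>u\<in>Poly_Mapping.keys x. ?s u * a) \<in> I" for k
      unfolding hom_part_sum hom_part_single_mult
      by (rule I_sum) (rule I_mult_left[OF ak single_F[OF x]])
    then have "hom_part d k (x * a) \<in> I" for k
      by (simp only: star_poly_mapping_eq_sum_single[of x, symmetric] flip: sum_distrib_right)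
    then show "x * a \<in> J"
      using F_closed(2)[OF x aF] by (simp add: J_def)
    have "hom_part d k (\<Sum>u\<in>Poly_Mapping.keys x. a * ?s u) \<in> I" for k
      unfolding hom_part_sum hom_part_mult_single
      by (rule I_sum) (rule I_mult_right[OF ak single_F[OF x]])
    then have "hom_part d k (a * x) \<in> I" for k
      by (simp only: star_poly_mapping_eq_sum_single[of x, symmetric] flip: sum_distrib_left)
    then show "a * x \<in> J"
      using F_closed(2)[OF aF x] by (simp add: J_def)
  qed
  have "ideal J F"
  proof (rule idealI)
    interpret ring F by (rule ring_free_star_algebra)
    show "subgroup J (add_monoid F)"
    proof (rule add.subgroupI)
      show "J \<subseteq> carrier F" by (auto simp: J_def)
      show "J \<noteq> {}" using I_0 by (auto simp: J_def intro!: exI[of _ 0])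
      show "\<ominus>\<^bsub>F\<^esub> a \<in> J" if "a \<in> J" for a
        using that a_inv_F[of a] F_uminus[of a] by (simp add: J_def hom_part_uminus I_uminus)
      show "a \<oplus>\<^bsub>F\<^esub> b \<in> J" if "a \<in> J" "b \<in> J" for a b
        using that F_closed(1)[of a b] by (simp add: J_def hom_part_add I_add)
    qed
  qed (use left right ring_free_star_algebra in auto)
  moreover have "p \<in> J" if p: "p \<in> I" "p \<in> H l" for p l
    using that hom_in_F[OF p(2)] by (simp add: J_def hom_part_hom_polys I_0)
  then have "R \<union> star_poly ` R \<subseteq> J"
    using rels_homogeneous rel_in_I star_rel_in_I hom_polys_star[of _ X d] by fast
  ultimately have "I \<subseteq> J"
    unfolding relation_ideal_def by (rule ring.genideal_minimal[OF ring_free_star_algebra])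
  then show ?thesis
    using assms by (auto simp: J_def)
qed

section \<open>Residue classes and the operations of the quotient\<close>

lemma mem_cls_iff:
  assumes "p \<in> carrier F" "r \<in> carrier F"
  shows "p \<in> cls r \<longleftrightarrow> p - r \<in> I"
proof -
  interpret I: ideal I F by (rule ideal_I)
  have "p \<in> cls r \<longleftrightarrow> p \<oplus>\<^bsub>F\<^esub> \<ominus>\<^bsub>F\<^esub> r \<in> I"
    unfolding cls_def using assms by (intro I.a_rcos_module)
  then show ?thesis
    using a_inv_F[OF assms(2)] by simp
qed

lemma cls_eq_iff:
  assumes "p \<in> carrier F" "r \<in> carrier F"
  shows "cls p = cls r \<longleftrightarrow> p - r \<in> I"
proof -
  interpret I: ideal I F by (rule ideal_I)
  have "cls r = cls p" if "p \<in> cls r"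
    using I.a_repr_independence'[OF that[unfolded cls_def] assms(2)] unfolding cls_def .
  moreover have "p \<in> cls p"
    unfolding cls_def by (rule I.a_rcos_self[OF assms(1)])
  ultimately show ?thesis
    unfolding mem_cls_iff[OF assms, symmetric] by auto
qed

lemma cls_0: "cls 0 = I"
proof -
  interpret I: ideal I F by (rule ideal_I)
  show ?thesis
    using I.a_rcos_const[OF I_0] by (simp add: cls_def)
qed

lemma cls_eq_zero_iff: "p \<in> carrier F \<Longrightarrow> cls p = cls 0 \<longleftrightarrow> p \<in> I"
  using cls_eq_iff[of p 0] by simp

lemma carrier_A: "carrier A = cls ` carrier F"
  by (auto simp: presented_star_algebra_def Let_def FactRing_def A_RCOSETS_def' cls_def)

lemma zero_A: "zero A = cls 0"
  by (simp add: presented_star_algebra_def Let_def FactRing_def cls_0)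

lemma cls_add: "p \<in> carrier F \<Longrightarrow> r \<in> carrier F \<Longrightarrow> cls p \<oplus>\<^bsub>A\<^esub> cls r = cls (p + r)"
  using ideal.a_rcos_sum[OF ideal_I, of p r]
  by (simp add: presented_star_algebra_def Let_def FactRing_def cls_def)

lemma cls_mult: "p \<in> carrier F \<Longrightarrow> r \<in> carrier F \<Longrightarrow> cls p \<otimes>\<^bsub>A\<^esub> cls r = cls (p * r)"
  using ideal.rcoset_mult_add[OF ideal_I, of p r]
  by (simp add: presented_star_algebra_def Let_def FactRing_def cls_def)

text \<open>In the quotient a scalar multiple is defined as a union over all representatives. The
  united cosets agree, as \<open>scalar c * (r - p)\<close> lies in \<open>I\<close>, and the union
  is not empty, as \<open>p\<close> represents its own class.\<close>

lemma cls_smult: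
  assumes "p \<in> carrier F"
  shows "c \<odot>\<^bsub>A\<^esub> cls p = cls (scalar c * p)"
proof -
  interpret I: ideal I F by (rule ideal_I)
  have "cls (scalar c * r) = cls (scalar c * p)" if "r \<in> cls p" for r
  proof -
    have r: "r \<in> carrier F"
      using that assms I.a_r_coset_subset_G[OF I.a_subset] unfolding cls_def by blast
    have "scalar c * (r - p) \<in> I"
      using that mem_cls_iff[OF r assms] by (intro I_scalar) simp
    then show ?thesis
      unfolding right_diff_distrib
        cls_eq_iff[OF F_closed(2)[OF hom_in_F[OF hom_polys_scalar] r]
          F_closed(2)[OF hom_in_F[OF hom_polys_scalar] assms]] .
  qed
  then have "(\<Union>r\<in>cls p. cls (scalar c * r)) = (\<Union>r\<in>cls p. cls (scalar c * p))"
    by (rule SUP_cong[OF refl])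
  also have "p \<in> cls p"
    using mem_cls_iff[OF assms assms] I_0 by simp
  then have "(\<Union>r\<in>cls p. cls (scalar c * p)) = cls (scalar c * p)"
    by blast
  finally show ?thesis
    by (simp add: presented_star_algebra_def Let_def cls_def)
qed

text \<open>The laws descend from the free algebra because \<open>cls\<close> is additive and onto
  the carrier.\<close>

lemma abelian_group_A: "abelian_group A"
proof -
  have A_cases: "\<exists>p. x = cls p \<and> p \<in> carrier F" if "x \<in> carrier A" for x
    using that unfolding carrier_A by blast
  show ?thesis
  proof (rule abelian_groupI)
    show "\<zero>\<^bsub>A\<^esub> \<in> carrier A"
      unfolding carrier_A zero_A by (intro imageI zero_in_F)
    fix x assume "x \<in> carrier A"
    then obtain p where p: "x = cls p" "p \<in> carrier F" using A_cases by blast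
    show "\<zero>\<^bsub>A\<^esub> \<oplus>\<^bsub>A\<^esub> x = x"
      unfolding zero_A p(1) cls_add[OF zero_in_F p(2)] by simp
    have "cls (- p) \<oplus>\<^bsub>A\<^esub> x = \<zero>\<^bsub>A\<^esub>"
      unfolding zero_A p(1) cls_add[OF F_uminus[OF p(2)] p(2)] by simp
    then show "\<exists>y\<in>carrier A. y \<oplus>\<^bsub>A\<^esub> x = \<zero>\<^bsub>A\<^esub>"
      using F_uminus[OF p(2)] unfolding carrier_A by blast
    fix y assume "y \<in> carrier A"
    then obtain r where r: "y = cls r" "r \<in> carrier F" using A_cases by blast
    show "x \<oplus>\<^bsub>A\<^esub> y \<in> carrier A"
      unfolding carrier_A p(1) r(1) cls_add[OF p(2) r(2)] by (intro imageI F_closed p r)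
    show "x \<oplus>\<^bsub>A\<^esub> y = y \<oplus>\<^bsub>A\<^esub> x"
      unfolding p(1) r(1) cls_add[OF p(2) r(2)] cls_add[OF r(2) p(2)] by (simp only: add.commute)
    fix t assume "t \<in> carrier A"
    then obtain s where s: "t = cls s" "s \<in> carrier F" using A_cases by blast
    show "x \<oplus>\<^bsub>A\<^esub> y \<oplus>\<^bsub>A\<^esub> t = x \<oplus>\<^bsub>A\<^esub> (y \<oplus>\<^bsub>A\<^esub> t)"
      unfolding p(1) r(1) s(1) cls_add[OF p(2) r(2)] cls_add[OF r(2) s(2)]
        cls_add[OF F_closed(1)[OF p(2) r(2)] s(2)] cls_add[OF p(2) F_closed(1)[OF r(2) s(2)]]
      by (simp only: add.assoc)
  qed
qed

lemma a_inv_A: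
  assumes p: "p \<in> carrier F"
  shows "\<ominus>\<^bsub>A\<^esub> cls p = cls (- p)"
proof -
  interpret A: abelian_group A by (rule abelian_group_A)
  have neg: "- p \<in> carrier F"
    by (rule F_uminus[OF p])
  show ?thesis
  proof (rule A.minus_equality)
    show "cls (- p) \<oplus>\<^bsub>A\<^esub> cls p = \<zero>\<^bsub>A\<^esub>"
      unfolding zero_A cls_add[OF neg p] by simp
    show "cls p \<in> carrier A" "cls (- p) \<in> carrier A"
      unfolding carrier_A by (intro imageI p neg)+
  qed
qed

lemma sum_in_F: "(\<And>k. k \<in> K \<Longrightarrow> g k \<in> carrier F) \<Longrightarrow> (\<Sum>k\<in>K. g k) \<in> carrier F"
  by (induction K rule: infinite_finite_induct) (auto intro: F_closed)

text \<open>Additivity of \<open>cls\<close> for finite families; it translates the record-level sum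
  in the definition of a grading into an ordinary sum of polynomials.\<close>

lemma finsum_A:
  assumes "finite K" and "\<And>k. k \<in> K \<Longrightarrow> g k \<in> carrier F"
  shows "(\<Oplus>\<^bsub>A\<^esub>k\<in>K. cls (g k)) = cls (\<Sum>k\<in>K. g k)"
  using assms
proof (induction K)
  interpret A: abelian_group A by (rule abelian_group_A)
  {
    case empty
    show ?case by (simp add: zero_A)
  next
    case (insert k K)
    have clsA: "cls (g i) \<in> carrier A" if "i \<in> insert k K" for i
      unfolding carrier_A by (intro imageI insert.prems that)
    have "(\<Oplus>\<^bsub>A\<^esub>i\<in>insert k K. cls (g i)) = cls (g k) \<oplus>\<^bsub>A\<^esub> (\<Oplus>\<^bsub>A\<^esub>i\<in>K. cls (g i))"
      using clsA by (intro A.finsum_insert insert.hyps Pi_I) simp_all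
    also have "(\<Oplus>\<^bsub>A\<^esub>i\<in>K. cls (g i)) = cls (\<Sum>i\<in>K. g i)"
      using insert by simp
    also have "cls (g k) \<oplus>\<^bsub>A\<^esub> cls (\<Sum>i\<in>K. g i) = cls (g k + (\<Sum>i\<in>K. g i))"
      by (intro cls_add sum_in_F insert.prems) simp_all
    finally show ?case
      using insert.hyps by simp
  }
qed

section \<open>The grading of the quotient\<close>

lemma degree_part_eq: "G k = cls ` H k"
  by (auto simp: degree_part_def hom_polys_def cls_def carrier_F)

lemma submodule_degree_part: "submodule (G k) complex_field A"
proof (rule submodule.intro)
  interpret A: abelian_group A by (rule abelian_group_A)
  show "subgroup (G k) (add_monoid A)"
  proof (rule A.add.subgroupI)
    show "G k \<subseteq> carrier A"
      unfolding carrier_A degree_part_eq using hom_in_F by blast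
    show "G k \<noteq> {}"
      unfolding degree_part_eq using hom_polys_0 by blast
    show "\<ominus>\<^bsub>A\<^esub> a \<in> G k" if "a \<in> G k" for a
    proof -
      obtain p where p: "a = cls p" "p \<in> H k"
        using \<open>a \<in> G k\<close> unfolding degree_part_eq by blast
      then show ?thesis
        unfolding degree_part_eq p(1) a_inv_A[OF hom_in_F[OF p(2)]] by (intro imageI hom_polys_uminus)
    qed
    show "a \<oplus>\<^bsub>A\<^esub> b \<in> G k" if "a \<in> G k" "b \<in> G k" for a b
    proof -
      obtain p r where p: "a = cls p" "p \<in> H k" and r: "b = cls r" "r \<in> H k"
        using \<open>a \<in> G k\<close> \<open>b \<in> G k\<close> unfolding degree_part_eq by blast
      then show ?thesis
        unfolding degree_part_eq p(1) r(1) cls_add[OF p(2)[THEN hom_in_F] r(2)[THEN hom_in_F]]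
        by (intro imageI hom_polys_add)
    qed
  qed
  show "submodule_axioms (G k) complex_field A"
  proof (unfold submodule_axioms_def degree_part_eq, clarify)
    show "c \<odot>\<^bsub>A\<^esub> cls p \<in> cls ` H k" if "p \<in> H k" for c p
      unfolding cls_smult[OF hom_in_F[OF that]] by (intro imageI hom_polys_scalar_mult that)
  qed
qed

lemma degree_part_mult: "G k <#>\<^bsub>A\<^esub> G l \<subseteq> G (k + l)"
proof -
  have "cls p \<otimes>\<^bsub>A\<^esub> cls r \<in> cls ` H (k + l)" if "p \<in> H k" "r \<in> H l" for p r
    unfolding cls_mult[OF that[THEN hom_in_F]] by (intro imageI hom_polys_mult that)
  then show ?thesis
    unfolding set_mult_def degree_part_eq by blast
qed

text \<open>Existence: project the components of a representative. Uniqueness rests on the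
  homogeneity of \<open>I\<close>: if two representatives differ by an element of \<open>I\<close>,
  so do their components.\<close>

lemma ex1_decomposition:
  assumes "a \<in> carrier A"
  shows "\<exists>!f. (\<forall>k. f k \<in> G k) \<and> finite {k. f k \<noteq> \<zero>\<^bsub>A\<^esub>} \<and>
           a = (\<Oplus>\<^bsub>A\<^esub>k\<in>{k. f k \<noteq> \<zero>\<^bsub>A\<^esub>}. f k)"
proof -
  interpret A: abelian_group A by (rule abelian_group_A)
  obtain p where p: "a = cls p" "p \<in> carrier F"
    using assms unfolding carrier_A by blast
  define f where "f k = cls (hom_part d k p)" for k
  show ?thesis
  proof (rule ex1I[of _ f], intro conjI allI)
    show "f k \<in> G k" for k
      using p(2) hom_part_in_hom_polys unfolding f_def degree_part_eq carrier_F by blast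
    define K where "K = word_degree d ` Poly_Mapping.keys p"
    have "finite K" by (simp add: K_def)
    have hom_part_out: "hom_part d k p = 0" if "k \<notin> K" for k
      using that by (auto simp: K_def keys_hom_part simp flip: keys_eq_empty)
    have sub: "{k. f k \<noteq> \<zero>\<^bsub>A\<^esub>} \<subseteq> K"
      using hom_part_out by (auto simp: f_def zero_A)
    then show "finite {k. f k \<noteq> \<zero>\<^bsub>A\<^esub>}"
      using \<open>finite K\<close> finite_subset by blast
    \<comment> \<open>A nonzero component may have class zero, so the support of \<open>f\<close>
      can be smaller than \<open>K\<close>; the extra terms vanish.\<close>
    have "(\<Oplus>\<^bsub>A\<^esub>k\<in>{k. f k \<noteq> \<zero>\<^bsub>A\<^esub>}. f k) = (\<Oplus>\<^bsub>A\<^esub>k\<in>K. f k)"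
    proof (rule A.add.finprod_mono_neutral_cong_left[OF \<open>finite K\<close> sub])
      show "f \<in> K \<rightarrow> carrier A"
        unfolding f_def carrier_A by (intro Pi_I imageI hom_part_in_F p(2))
    qed simp_all
    also have "\<dots> = cls (\<Sum>k\<in>K. hom_part d k p)"
      unfolding f_def by (rule finsum_A[OF \<open>finite K\<close> hom_part_in_F[OF p(2)]])
    also have "\<dots> = a"
      using hom_part_decomposition[OF \<open>finite K\<close>, of d p] p(1) by (simp add: K_def)
    finally show "a = (\<Oplus>\<^bsub>A\<^esub>k\<in>{k. f k \<noteq> \<zero>\<^bsub>A\<^esub>}. f k)" ..
  next
    fix g
    assume "(\<forall>k. g k \<in> G k) \<and> finite {k. g k \<noteq> \<zero>\<^bsub>A\<^esub>} \<and>
      a = (\<Oplus>\<^bsub>A\<^esub>k\<in>{k. g k \<noteq> \<zero>\<^bsub>A\<^esub>}. g k)"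
    then have g: "\<forall>k. g k \<in> G k" and fin: "finite {k. g k \<noteq> \<zero>\<^bsub>A\<^esub>}"
      and a: "a = (\<Oplus>\<^bsub>A\<^esub>k\<in>{k. g k \<noteq> \<zero>\<^bsub>A\<^esub>}. g k)"
      by auto
    define K where "K = {k. g k \<noteq> \<zero>\<^bsub>A\<^esub>}"
    have "\<forall>k. \<exists>r. r \<in> H k \<and> g k = cls r"
      using g unfolding degree_part_eq by blast
    then obtain h where h: "h k \<in> H k" "g k = cls (h k)" for k
      by metis
    have "cls p = (\<Oplus>\<^bsub>A\<^esub>k\<in>K. cls (h k))"
      using a p(1) by (simp add: K_def h(2))
    also have "\<dots> = cls (\<Sum>k\<in>K. h k)"
      using fin hom_in_F[OF h(1)] unfolding K_def by (rule finsum_A)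
    finally have I: "p - (\<Sum>k\<in>K. h k) \<in> I"
      by (simp only: cls_eq_iff[OF p(2) sum_in_F[OF hom_in_F[OF h(1)]]])
    show "g = f"
    proof
      fix l
      \<comment> \<open>Outside \<open>K\<close> the class \<open>g l\<close> is zero, so
        \<open>0\<close> may stand for \<open>h l\<close> there.\<close>
      have "hom_part d l (\<Sum>k\<in>K. h k) = (if l \<in> K then h l else 0)"
        unfolding hom_part_sum hom_part_hom_polys[OF h(1)] using fin by (simp add: K_def)
      then have "hom_part d l p - (if l \<in> K then h l else 0) \<in> I"
        using hom_part_I[OF I, of l] by (simp add: hom_part_diff)
      moreover have "(if l \<in> K then h l else 0) \<in> carrier F"
        using hom_in_F[OF h(1)] by simp
      ultimately have "f l = cls (if l \<in> K then h l else 0)"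
        unfolding f_def by (simp only: cls_eq_iff[OF hom_part_in_F[OF p(2)]])
      also have "\<dots> = g l"
        by (auto simp: K_def zero_A h(2))
      finally show "g l = f l" ..
    qed
  qed
qed

lemma graded: "graded_algebra A G"
  unfolding graded_algebra_def
  by (intro conjI allI ballI submodule_degree_part ex1_decomposition degree_part_mult)

section \<open>Products of homogeneous parts\<close>

text \<open>The preimage in the free algebra of the span of \<open>G k <#>\<^bsub>A\<^esub> G l\<close>.\<close>

inductive_set prods :: "int \<Rightarrow> int \<Rightarrow> 'g star_poly set" for k l where
  rel: "p \<in> I \<Longrightarrow> p \<in> prods k l"
| prod: "p \<in> H k \<Longrightarrow> r \<in> H l \<Longrightarrow> p * r \<in> prods k l"
| add: "p \<in> prods k l \<Longrightarrow> r \<in> prods k l \<Longrightarrow> p + r \<in> prods k l"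

text \<open>The outer factors are absorbed by the neighbouring factor of each product, and
  \<open>I\<close> is two-sided. With \<open>i = j = 0\<close>, \<open>prods k l\<close> is closed
  under multiplication by degree-zero elements.\<close>

lemma prods_mult:
  assumes "p \<in> prods k l" "a \<in> H i" "b \<in> H j"
  shows "a * p * b \<in> prods (i + k) (l + j)"
  using assms
proof induction
  case (rel p)
  show ?case
    by (rule prods.rel[OF I_mult_right[OF I_mult_left]]) (use rel hom_in_F in auto)
next
  case (prod p r)
  then have "(a * p) * (r * b) \<in> prods (i + k) (l + j)"
    by (intro prods.prod hom_polys_mult)
  then show ?case by (simp add: mult.assoc)
next
  case (add p r)
  then show ?case
    by (simp add: distrib_left distrib_right prods.add)
qed

lemma prods_mult_left: "p \<in> prods k l \<Longrightarrow> a \<in> H i \<Longrightarrow> a * p \<in> prods (i + k) l"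
  using prods_mult[of p k l a i 1 0] by simp

lemma prods_mult_right: "p \<in> prods k l \<Longrightarrow> b \<in> H j \<Longrightarrow> p * b \<in> prods k (l + j)"
  using prods_mult[of p k l 1 0 b j] by simp

lemma prods_scalar: "p \<in> prods k l \<Longrightarrow> scalar c * p \<in> prods k l"
  using prods_mult_left[OF _ hom_polys_scalar] by fastforce

lemma prods_diff: "p \<in> prods k l \<Longrightarrow> r \<in> prods k l \<Longrightarrow> p - r \<in> prods k l"
  using prods.add[OF _ prods_scalar[of r k l "- 1"], of p] by (simp add: scalar_uminus)

lemma prods_sum: "(\<And>j. j \<in> S \<Longrightarrow> f j \<in> prods k l) \<Longrightarrow> (\<Sum>j\<in>S. f j) \<in> prods k l"
  by (induction S rule: infinite_finite_induct) (auto intro: prods.add prods.rel I_0)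

text \<open>\<open>prods\<close> is a union of residue classes, so the relations of the algebra may
  be used as equations when membership is proved.\<close>

lemma prods_cong:
  assumes "p - r \<in> I" "r \<in> prods k l"
  shows "p \<in> prods k l"
  using prods.add[OF prods.rel[OF assms(1)] assms(2)] by simp

lemma prods_in_F: "p \<in> prods k l \<Longrightarrow> p \<in> carrier F"
proof (induction rule: prods.induct)
  case (prod p r)
  then show ?case using F_closed(2)[OF hom_in_F hom_in_F] by blast
qed (simp_all add: I_in_F F_closed)

text \<open>Write \<open>1\<close> modulo \<open>I\<close> as a sum of products \<open>p * r\<close>
  of degrees \<open>k\<close> and \<open>- k\<close>, then insert
  \<open>1 \<in> prods l (- l)\<close> between the factors.\<close>

lemma prods_trans:
  assumes "1 \<in> prods k (- k)" "1 \<in> prods l (- l)"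
  shows "1 \<in> prods (k + l) (- (k + l))"
proof -
  have "p \<in> prods (k + l) (- (k + l))" if "p \<in> prods k (- k)" for p
    using that
  proof induction
    case (prod p r)
    then show ?case using prods_mult[OF assms(2) prod] by (simp add: algebra_simps)
  qed (auto intro: prods.rel prods.add)
  then show ?thesis using assms(1) by blast
qed

text \<open>Starting from \<open>1 = 1 * 1\<close> in degree zero, the two hypotheses move
  \<open>k\<close> up and down by one.\<close>

lemma one_in_prods:
  assumes "1 \<in> prods 1 (- 1)" "1 \<in> prods (- 1) 1"
  shows "1 \<in> prods k (- k)"
proof (induction k rule: int_induct[of _ 0])
  case base
  show ?case using prods.prod[of 1 0 1 0] by simp
next
  case (step1 i)
  then show ?case using prods_trans[of i 1] assms by simp
next
  case (step2 i)
  then show ?case using prods_trans[of i "- 1"] assms by simp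
qed

text \<open>An element of degree \<open>k + l\<close> is \<open>1\<close> times itself; once
  \<open>1\<close> is a sum of products of degrees \<open>k\<close> and \<open>- k\<close>, the
  second factors absorb the element and get degree \<open>l\<close>.\<close>

theorem strongly_gradedI:
  assumes "1 \<in> prods 1 (- 1)" "1 \<in> prods (- 1) 1"
  shows "strongly_graded A G"
proof -
  interpret A: abelian_group A by (rule abelian_group_A)
  have "G (k + l) \<subseteq> lin_span A (G k <#>\<^bsub>A\<^esub> G l)" for k l
  proof -
    \<comment> \<open>The span is a hull, hence the test against every submodule \<open>V\<close>
      that contains the products.\<close>
    have "cls p \<in> V" if V: "submodule V complex_field A" "G k <#>\<^bsub>A\<^esub> G l \<subseteq> V"
      and p: "p \<in> H (k + l)" for V p
    proof -
      interpret V: submodule V complex_field A by (rule V(1))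
      have "1 * p \<in> prods k (- k + (k + l))"
        using prods_mult_right[OF one_in_prods[OF assms] p] .
      then have "p \<in> prods k l" by simp
      then show ?thesis
      proof induction
        case (rel p)
        then have "cls p = \<zero>\<^bsub>A\<^esub>"
          unfolding zero_A cls_eq_zero_iff[OF I_in_F[OF rel]] .
        then show ?case using V.one_closed by simp
      next
        case (prod p r)
        then have "cls p \<otimes>\<^bsub>A\<^esub> cls r \<in> G k <#>\<^bsub>A\<^esub> G l"
          unfolding set_mult_def degree_part_eq by blast
        then show ?case
          unfolding cls_mult[OF prod(1)[THEN hom_in_F] prod(2)[THEN hom_in_F]]
          by (rule subsetD[OF V(2)])
      next
        case (add p r)
        then have "cls p \<oplus>\<^bsub>A\<^esub> cls r \<in> V" using V.m_closed by simp
        then show ?case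
          unfolding cls_add[OF add(1)[THEN prods_in_F] add(2)[THEN prods_in_F]] .
      qed
    qed
    then show ?thesis
      unfolding lin_span_def hull_def degree_part_eq[of "k + l"] by auto
  qed
  moreover have "lin_span A (G k <#>\<^bsub>A\<^esub> G l) \<subseteq> G (k + l)" for k l
    unfolding lin_span_def by (intro hull_minimal degree_part_mult submodule_degree_part)
  ultimately show ?thesis
    unfolding strongly_graded_def by (intro conjI graded allI subset_antisym)
qed

section \<open>Cancelling powers by a q-oscillator relation\<close>

text \<open>Induction on \<open>N\<close>: multiply the congruence by \<open>a\<close> on the right
  and apply \<open>D\<close> to the last \<open>b * a\<close>. With \<open>c' = c ^ Suc N\<close>
  the coefficient of the pure power of \<open>a\<close> becomes
  \<open>(1 - c') + c' * (1 - c) = 1 - c * c'\<close>.\<close>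

lemma swap_power_mod_I:
  assumes ab: "a \<in> H e" "b \<in> H (- e)"
    and D: "b * a - (scalar (1 - c) + scalar c * (a * b)) \<in> I"
  shows "b * a ^ Suc N - (scalar (1 - c ^ Suc N) * a ^ N + scalar (c ^ Suc N) * (a ^ Suc N * b)) \<in> I"
proof (induction N)
  case 0
  then show ?case using D by simp
next
  case (Suc N)
  define P where "P = a ^ N"
  have aF: "a \<in> carrier F" "a ^ Suc N \<in> carrier F"
    by (rule hom_in_F[OF ab(1)], rule hom_in_F[OF hom_polys_power[OF ab(1)]])
  have pow: "a ^ Suc N = P * a" "a ^ Suc (Suc N) = P * a * a"
    by (simp_all only: P_def power_Suc2)
  let ?E = "b * a ^ Suc N - (scalar (1 - c ^ Suc N) * a ^ N + scalar (c ^ Suc N) * (a ^ Suc N * b))"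
  let ?D = "b * a - (scalar (1 - c) + scalar c * (a * b))"
  \<comment> \<open>\<open>c'\<close> stands for \<open>c ^ Suc N\<close> and \<open>P\<close> for
    \<open>a ^ N\<close>, as atoms for the simplifier. The two summands on the right lie in
    \<open>I\<close> by the induction hypothesis and by \<open>D\<close>.\<close>
  have "b * (P * a * a) - (scalar (1 - c * c') * (P * a) + scalar (c * c') * (P * a * a * b)) =
      (b * (P * a) - (scalar (1 - c') * P + scalar c' * (P * a * b))) * a +
      scalar c' * ((P * a) * ?D)" for c'
    by (simp add: algebra_simps scalar_diff scalar_scalar scalar_commute[of a] scalar_commute[of P]
        scalar_left_commute[of a] scalar_left_commute[of P])
  from this[of "c ^ Suc N"]
  have "b * a ^ Suc (Suc N) - (scalar (1 - c ^ Suc (Suc N)) * a ^ Suc N +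
      scalar (c ^ Suc (Suc N)) * (a ^ Suc (Suc N) * b)) = ?E * a + scalar (c ^ Suc N) * (a ^ Suc N * ?D)"
    unfolding pow P_def[symmetric] power_Suc[of c "Suc N"] .
  then show ?case
    using I_add[OF I_mult_right[OF Suc aF(1)] I_scalar[OF I_mult_left[OF D aF(2)]]] by simp
qed

text \<open>Descent on \<open>N\<close>: multiplying the congruence for \<open>b * a ^ Suc N\<close>
  by \<open>x * b ^ N\<close> on the left expresses a nonzero multiple of
  \<open>x * b ^ N * a ^ N\<close> through \<open>x * b ^ Suc N * a ^ Suc N\<close> and a product of
  degrees \<open>e\<close> and \<open>- e\<close>.\<close>

lemma prods_cancel_powers:
  assumes ab: "a \<in> H e" "b \<in> H (- e)"
    and D: "b * a - (scalar (1 - c) + scalar c * (a * b)) \<in> I"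
    and c: "\<And>k. c ^ Suc k \<noteq> 1"
    and x: "x \<in> H 0"
    and "x * b ^ N * a ^ N \<in> prods e (- e)"
  shows "x \<in> prods e (- e)"
  using assms(6)
proof (induction N)
  case (Suc N)
  let ?c = "c ^ Suc N"
  define E where "E = b * a ^ Suc N - (scalar (1 - ?c) * a ^ N + scalar ?c * (a ^ Suc N * b))"
  have "E \<in> I"
    unfolding E_def by (rule swap_power_mod_I[OF ab D])
  have xb: "x * b ^ N \<in> H (0 + int N * (- e))"
    by (intro hom_polys_mult hom_polys_power x ab)
  \<comment> \<open>\<open>N\<close> factors of degree \<open>- e\<close> against
    \<open>Suc N\<close> of degree \<open>e\<close> leave degree \<open>e\<close>, so a further
    factor \<open>b\<close> completes a product of degrees \<open>e\<close> and
    \<open>- e\<close>.\<close>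
  have "x * b ^ N * a ^ Suc N \<in> H (0 + int N * (- e) + int (Suc N) * e)"
    by (intro hom_polys_mult[OF xb] hom_polys_power ab)
  then have "x * b ^ N * a ^ Suc N \<in> H e"
    by (simp add: algebra_simps)
  then have "scalar ?c * (x * b ^ N * a ^ Suc N * b) \<in> prods e (- e)"
    by (intro prods_scalar prods.prod ab)
  moreover have "x * b ^ N * E \<in> prods e (- e)"
    by (rule prods.rel[OF I_mult_left[OF \<open>E \<in> I\<close> hom_in_F[OF xb]]])
  moreover have "scalar (1 - ?c) * (x * b ^ N * a ^ N) =
      x * b ^ Suc N * a ^ Suc N - x * b ^ N * E - scalar ?c * (x * b ^ N * a ^ Suc N * b)"
  proof -
    define y where "y = x * b ^ N"
    have "x * b ^ Suc N * a ^ Suc N = y * (b * a ^ Suc N)"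
      by (simp only: y_def power_Suc2 mult.assoc)
    then show ?thesis
      unfolding y_def[symmetric] E_def
      by (simp only: right_diff_distrib distrib_left scalar_left_commute[of y] mult.assoc) simp
  qed
  ultimately have "scalar (1 - ?c) * (x * b ^ N * a ^ N) \<in> prods e (- e)"
    using Suc.prems by (simp only: prods_diff)
  \<comment> \<open>The divisor \<open>1 - c ^ Suc N\<close> is nonzero because \<open>c\<close> is
    not a root of unity.\<close>
  then have "scalar (1 / (1 - ?c)) * (scalar (1 - ?c) * (x * b ^ N * a ^ N)) \<in> prods e (- e)"
    by (rule prods_scalar)
  then have "x * b ^ N * a ^ N \<in> prods e (- e)"
    unfolding scalar_scalar using c[of N] by simp
  then show ?case by (rule Suc.IH)
qed simp

text \<open>Each passage of \<open>v\<close> across one factor \<open>b\<close> contributes a factor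
  \<open>s\<close>.\<close>

lemma q_commute_power_mod_I:
  assumes b: "b \<in> H k"
    and vb: "v * b - scalar s * (b * v) \<in> I"
  shows "v * b ^ N - scalar (s ^ N) * (b ^ N * v) \<in> I"
proof (induction N)
  case (Suc N)
  define P where "P = b ^ N"
  have bF: "b \<in> carrier F" "P \<in> carrier F"
    unfolding P_def by (rule hom_in_F[OF b], rule hom_in_F[OF hom_polys_power[OF b]])
  have "v * (P * b) - scalar (t * s) * (P * b * v) =
      (v * P - scalar t * (P * v)) * b + scalar t * (P * (v * b - scalar s * (b * v)))" for t
    by (simp add: algebra_simps scalar_scalar scalar_left_commute[of P])
  from this[of "s ^ N"] show ?case
    using I_add[OF I_mult_right[OF Suc bF(1)] I_scalar[OF I_mult_left[OF vb bF(2)]]]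
    unfolding power_Suc2 P_def[symmetric] by simp
qed (simp add: I_0)

text \<open>Modulo \<open>I\<close>, \<open>u * v * b ^ N * a ^ N\<close> is \<open>s ^ N\<close>
  times the product of \<open>u * b ^ N\<close> and \<open>v * a ^ N\<close>, whose degrees are
  \<open>e\<close> and \<open>- e\<close>; then the powers are cancelled. The sign of
  \<open>e\<close> is free, so \<open>a\<close> can be \<open>z 0\<close> or
  \<open>zs 0\<close>.\<close>

lemma prods_of_q_commute:
  assumes ab: "a \<in> H e" "b \<in> H (- e)"
    and D: "b * a - (scalar (1 - c) + scalar c * (a * b)) \<in> I"
    and c: "\<And>k. c ^ Suc k \<noteq> 1"
    and uv: "u \<in> H (int (Suc N) * e)" "v \<in> H (- (int (Suc N) * e))"
    and vb: "v * b - scalar s * (b * v) \<in> I"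
  shows "u * v \<in> prods e (- e)"
proof (rule prods_cancel_powers[OF ab D c])
  show "u * v \<in> H 0"
    using hom_polys_mult[OF uv] by simp
  have aN: "a ^ N \<in> H (int N * e)" and bN: "b ^ N \<in> H (int N * (- e))"
    by (intro hom_polys_power ab)+
  show "u * v * b ^ N * a ^ N \<in> prods e (- e)"
  proof (rule prods_cong)
    have "u * v * b ^ N * a ^ N - scalar (s ^ N) * ((u * b ^ N) * (v * a ^ N)) =
        u * (v * b ^ N - scalar (s ^ N) * (b ^ N * v)) * a ^ N"
      by (simp add: algebra_simps scalar_left_commute[of u])
    then show "u * v * b ^ N * a ^ N - scalar (s ^ N) * ((u * b ^ N) * (v * a ^ N)) \<in> I"
      using I_mult_right[OF I_mult_left[OF q_commute_power_mod_I[OF ab(2) vb] hom_in_F[OF uv(1)]]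
          hom_in_F[OF aN], of N] by simp
    have "u * b ^ N \<in> H e" "v * a ^ N \<in> H (- e)"
      using hom_polys_mult[OF uv(1) bN] hom_polys_mult[OF uv(2) aN] by (simp_all add: algebra_simps)
    then show "scalar (s ^ N) * ((u * b ^ N) * (v * a ^ N)) \<in> prods e (- e)"
      by (intro prods_scalar prods.prod)
  qed
qed

end

section \<open>The quantum spheres\<close>

lemma star_poly_single: "star_poly (Poly_Mapping.single u c) = Poly_Mapping.single (star_word u) (cnj c)"
  by (simp add: star_poly_def)

text \<open>Cancellation may shrink the support of \<open>p + r\<close>, but a zero coefficient
  contributes zero, so the sums over keys still add up.\<close>

lemma star_poly_add: "star_poly (p + r) = star_poly p + star_poly r"
  unfolding star_poly_def
  by (rule setsum_keys_plus_distrib) (simp_all add: single_add)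

lemma star_poly_uminus: "star_poly (- p) = - star_poly p"
  by (simp add: star_poly_def single_uminus sum_negf)

lemma star_poly_diff: "star_poly (p - r) = star_poly p - star_poly r"
  using star_poly_add[of p "- r"] by (simp add: star_poly_uminus)

text \<open>The star reverses products and the coefficient \<open>q\<close> is real. This yields the
  relation between two adjoints, which is not itself listed in \<open>sphere_rels\<close>.\<close>

lemma star_poly_gen_q_commute:
  "star_poly (gen x * gen y - scalar (of_real q) * (gen y * gen x)) =
     adj y * adj x - scalar (of_real q) * (adj x * adj y)"
  by (simp add: star_poly_diff gen_def adj_def scalar_def mult_single star_poly_single
      star_word_def plus_word_def zero_word_def)

text \<open>Exchanging two factors keeps the degree, and \<open>z j * zs j\<close> has degree zero.
  \<open>X\<close> may contain further generators, so that both algebras are covered.\<close>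

lemma sphere_rels_homogeneous:
  assumes "sphere_gens n \<subseteq> X"
  shows "sphere_rels q n \<subseteq> (\<Union>k. hom_polys X d k)"
proof -
  let ?H = "hom_polys X d"
  have z: "z i \<in> ?H (d (Z i))" and zs: "zs i \<in> ?H (- d (Z i))" if "i \<le> n" for i
    using assms that by (auto simp: sphere_gens_def intro!: hom_polys_gen hom_polys_adj)
  have zzs: "z i * zs i \<in> ?H 0" and zsz: "zs i * z i \<in> ?H 0" if "i \<le> n" for i
    using hom_polys_mult[OF z[OF that] zs[OF that]] hom_polys_mult[OF zs[OF that] z[OF that]] by simp_all
  have sum: "(\<Sum>j=k..n. z j * zs j) \<in> ?H 0" for k
    by (rule hom_polys_sum) (simp add: zzs)
  have 1: "z i * z j - scalar c * (z j * z i) \<in> ?H (d (Z i) + d (Z j))" if "i < j" "j \<le> n" for i j c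
  proof -
    have "z i * z j \<in> ?H (d (Z i) + d (Z j))" "z j * z i \<in> ?H (d (Z j) + d (Z i))"
      using that by (intro hom_polys_mult z; simp)+
    then show ?thesis
      unfolding add.commute[of "d (Z j)"] by (intro hom_polys_diff hom_polys_scalar_mult)
  qed
  have 2: "z i * zs j - scalar c * (zs j * z i) \<in> ?H (d (Z i) + - d (Z j))" if "i \<le> n" "j \<le> n" for i j c
  proof -
    have "z i * zs j \<in> ?H (d (Z i) + - d (Z j))" "zs j * z i \<in> ?H (- d (Z j) + d (Z i))"
      using that by (intro hom_polys_mult z zs; simp)+
    then show ?thesis
      unfolding add.commute[of "- d (Z j)"] by (intro hom_polys_diff hom_polys_scalar_mult)
  qed
  have 3: "z i * zs i - (zs i * z i + scalar c * (\<Sum>j=i+1..n. z j * zs j)) \<in> ?H 0" if "i \<le> n" for i c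
    by (intro hom_polys_diff hom_polys_add hom_polys_scalar_mult zzs zsz sum that)
  have 4: "(\<Sum>j=0..n. z j * zs j) - 1 \<in> ?H 0"
    by (intro hom_polys_diff sum hom_polys_1)
  show ?thesis
    unfolding sphere_rels_def
    by (intro Un_least subsetI; elim CollectE exE conjE singletonE; hypsubst;
        rule UN_I[OF UNIV_I]; (rule 1 2 3 4; assumption))
qed

text \<open>Powers are injective on the nonnegative reals. Applied to \<open>q\<^sup>2\<close> and
  its inverse, this says that the constant \<open>c\<close> of the cancellation is not a root of
  unity.\<close>

lemma power_neq_1:
  assumes "0 < (r::real)" "r \<noteq> 1"
  shows "(complex_of_real r) ^ Suc k \<noteq> 1"
proof
  assume "(complex_of_real r) ^ Suc k = 1"
  then have "complex_of_real (r ^ Suc k) = complex_of_real 1"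
    by simp
  then have "r ^ Suc k = 1 ^ Suc k"
    unfolding of_real_eq_iff by simp
  then have "r = 1"
    by (rule power_eq_imp_eq_base) (use assms in auto)
  with assms show False by simp
qed

section \<open>Presentations that contain the sphere relations\<close>

text \<open>Generators and relations of the sphere are only required to be included in
  \<open>X\<close> and \<open>R\<close>, so both algebras are instances and the argument is made
  once.\<close>

locale weighted_sphere_presentation = graded_presentation X R d
  for X :: "generator set" and R d +
  fixes q :: real and n :: nat
  assumes q: "0 < q" "q < 1"
    and sphere_gens: "sphere_gens n \<subseteq> X"
    and sphere_rels: "sphere_rels q n \<subseteq> R"
    and degree_0: "d (Z 0) = 1"
    and degree_pos: "\<And>i. i \<le> n \<Longrightarrow> 0 < d (Z i)"
begin

lemma z_hom: "i \<le> n \<Longrightarrow> z i \<in> H (d (Z i))" and zs_hom: "i \<le> n \<Longrightarrow> zs i \<in> H (- d (Z i))"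
  using sphere_gens by (auto simp: sphere_gens_def intro!: hom_polys_gen hom_polys_adj)

lemma z_zs_relation:
  assumes "i \<le> n"
  shows "z i * zs i - (zs i * z i + scalar (of_real (1 / q\<^sup>2 - 1)) * (\<Sum>j=i+1..n. z j * zs j)) \<in> I"
  by (rule rel_in_I, rule subsetD[OF sphere_rels], unfold sphere_rels_def,
      rule UnI1, rule UnI2)
    (intro CollectI exI[of _ i] conjI refl assms)

lemma sphere_relation: "(\<Sum>j=0..n. z j * zs j) - 1 \<in> I"
  by (rule rel_in_I, rule subsetD[OF sphere_rels], unfold sphere_rels_def, rule UnI2) simp

text \<open>The second relation is the adjoint of the first, and the ideal contains the adjoints of
  all relations.\<close>

lemma z_z_relation:
  assumes "i < j" "j \<le> n"
  shows "z i * z j - scalar (of_real q) * (z j * z i) \<in> I"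
    and "zs j * zs i - scalar (of_real q) * (zs i * zs j) \<in> I"
proof -
  have "z i * z j - scalar (of_real q) * (z j * z i) \<in> R"
    by (rule subsetD[OF sphere_rels], unfold sphere_rels_def, rule UnI1, rule UnI1, rule UnI1)
      (rule CollectI, rule exI[of _ i], rule exI[of _ j], intro conjI refl assms)
  from rel_in_I[OF this] star_rel_in_I[OF this]
  show "z i * z j - scalar (of_real q) * (z j * z i) \<in> I"
    and "zs j * zs i - scalar (of_real q) * (zs i * zs j) \<in> I"
    unfolding star_poly_gen_q_commute .
qed

text \<open>The defining relation for \<open>z 0\<close> with the sum over \<open>j \<ge> 1\<close>
  replaced by \<open>1 - z 0 * zs 0\<close>; this is hypothesis \<open>D\<close> for
  \<open>a = z 0\<close>, \<open>b = zs 0\<close>, \<open>c = 1 / q\<^sup>2\<close>.\<close>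

lemma zs_0_z_0:
  "zs 0 * z 0 - (scalar (1 - of_real (1 / q\<^sup>2)) + scalar (of_real (1 / q\<^sup>2)) * (z 0 * zs 0)) \<in> I"
proof -
  let ?t = "scalar (of_real (1 / q\<^sup>2 - 1)) :: generator star_poly"
  have sum: "(\<Sum>j=0..n. z j * zs j) = z 0 * zs 0 + (\<Sum>j=0+1..n. z j * zs j)"
    by (simp add: sum.atLeast_Suc_atMost)
  have "zs 0 * z 0 - (scalar (1 - of_real (1 / q\<^sup>2)) + scalar (of_real (1 / q\<^sup>2)) * (z 0 * zs 0)) =
      - (z 0 * zs 0 - (zs 0 * z 0 + ?t * (\<Sum>j=0+1..n. z j * zs j))) - ?t * ((\<Sum>j=0..n. z j * zs j) - 1)"
    unfolding sum of_real_diff of_real_1 scalar_diff scalar_1 by (simp add: algebra_simps)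
  also have "\<dots> \<in> I"
    by (rule I_diff[OF I_uminus[OF z_zs_relation[OF le0]] I_scalar[OF sphere_relation]])
  finally show ?thesis .
qed

text \<open>The relation \<open>zs_0_z_0\<close> times \<open>- q\<^sup>2\<close>, solved for
  \<open>z 0 * zs 0\<close>: hypothesis \<open>D\<close> with \<open>z 0\<close> and
  \<open>zs 0\<close> exchanged and \<open>c\<close> inverted.\<close>

lemma z_0_zs_0:
  "z 0 * zs 0 - (scalar (1 - of_real (q\<^sup>2)) + scalar (of_real (q\<^sup>2)) * (zs 0 * z 0)) \<in> I"
proof -
  define a b where "a = complex_of_real (q\<^sup>2)" and "b = complex_of_real (1 / q\<^sup>2)"
  have "a * b = 1"
    using q by (simp add: a_def b_def flip: of_real_mult)
  then have ab: "- a * (1 - b) = 1 - a" "- a * b = - 1"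
    by (simp_all add: algebra_simps)
  have "scalar (- a) * (zs 0 * z 0 - (scalar (1 - b) + scalar b * (z 0 * zs 0))) =
      scalar (- a) * (zs 0 * z 0) - (scalar (1 - a) + scalar (- 1) * (z 0 * zs 0))"
    unfolding right_diff_distrib[of "scalar (- a)"] distrib_left scalar_scalar
      scalar_mult[symmetric] ab ..
  also have "\<dots> = z 0 * zs 0 - (scalar (1 - a) + scalar a * (zs 0 * z 0))"
    by (simp add: scalar_uminus)
  finally have eq: "scalar (- a) * (zs 0 * z 0 - (scalar (1 - b) + scalar b * (z 0 * zs 0))) =
      z 0 * zs 0 - (scalar (1 - a) + scalar a * (zs 0 * z 0))" .
  show ?thesis
    using I_scalar[OF zs_0_z_0, of "- a"] unfolding a_def[symmetric] b_def[symmetric] eq .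
qed

text \<open>The commutation relation of \<open>z 0\<close> and \<open>z j\<close> divided by
  \<open>- q\<close>, in the form that moves \<open>z j\<close> past \<open>z 0\<close>.\<close>

lemma z_z_0:
  assumes "0 < j" "j \<le> n"
  shows "z j * z 0 - scalar (of_real (1 / q)) * (z 0 * z j) \<in> I"
proof -
  define a b where "a = complex_of_real q" and "b = complex_of_real (1 / q)"
  have ab: "- b * a = - 1"
    using q by (simp add: a_def b_def flip: of_real_mult)
  have "scalar (- b) * (z 0 * z j - scalar a * (z j * z 0)) =
      scalar (- b) * (z 0 * z j) - scalar (- 1) * (z j * z 0)"
    unfolding right_diff_distrib scalar_scalar ab ..
  also have "\<dots> = z j * z 0 - scalar b * (z 0 * z j)"
    by (simp add: scalar_uminus)
  finally have eq: "scalar (- b) * (z 0 * z j - scalar a * (z j * z 0)) =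
      z j * z 0 - scalar b * (z 0 * z j)" .
  show ?thesis
    using I_scalar[OF z_z_relation(1)[OF assms], of "- b"] unfolding a_def[symmetric] b_def[symmetric] eq .
qed

lemma degree_Suc:
  assumes "i \<le> n"
  obtains N where "d (Z i) = int (Suc N)"
proof
  show "d (Z i) = int (Suc (nat (d (Z i) - 1)))"
    using degree_pos[OF assms] by simp
qed

text \<open>Cancellation with \<open>a = z 0\<close>, \<open>b = zs 0\<close>,
  \<open>u = z j\<close>, \<open>v = zs j\<close>, \<open>s = q\<close>; for \<open>j = 0\<close>
  the element is already a product of degrees \<open>1\<close> and \<open>- 1\<close>.\<close>

lemma z_zs_in_prods:
  assumes "j \<le> n"
  shows "z j * zs j \<in> prods 1 (- 1)"
proof (cases "j = 0")
  case True
  then show ?thesis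
    using z_hom[of 0] zs_hom[of 0] degree_0 by (auto intro: prods.prod)
next
  case False
  obtain N where N: "d (Z j) = int (Suc N)"
    using degree_Suc[OF assms] .
  have c: "complex_of_real (1 / q\<^sup>2) ^ Suc k \<noteq> 1" for k
    using q by (intro power_neq_1) (auto simp: power2_eq_1_iff)
  show ?thesis
  proof (rule prods_of_q_commute[OF _ _ zs_0_z_0 c])
    show "z 0 \<in> H 1" "zs 0 \<in> H (- 1)"
      using z_hom[of 0] zs_hom[of 0] degree_0 by simp_all
    show "z j \<in> H (int (Suc N) * 1)" "zs j \<in> H (- (int (Suc N) * 1))"
      using z_hom[OF assms] zs_hom[OF assms] by (simp_all only: N mult_1_right)
    show "zs j * zs 0 - scalar (of_real q) * (zs 0 * zs j) \<in> I"
      by (rule z_z_relation) (use False assms in auto)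
  qed
qed

text \<open>The mirror image: \<open>e = - 1\<close>, \<open>a = zs 0\<close>,
  \<open>b = z 0\<close>, \<open>c = q\<^sup>2\<close>, \<open>s = 1 / q\<close>. The left factor
  \<open>u\<close> has the sign of \<open>e\<close>, so here it is \<open>zs j\<close>.\<close>

lemma zs_z_in_prods:
  assumes "0 < j" "j \<le> n"
  shows "zs j * z j \<in> prods (- 1) 1"
proof -
  obtain N where N: "d (Z j) = int (Suc N)"
    using degree_Suc[OF assms(2)] .
  have c: "complex_of_real (q\<^sup>2) ^ Suc k \<noteq> 1" for k
  proof (rule power_neq_1)
    show "0 < q\<^sup>2" "q\<^sup>2 \<noteq> 1"
      using q power_less_one_iff[of q 2] by auto
  qed
  \<comment> \<open>\<open>- (- 1)\<close> is kept so that the second degree has the shape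
    \<open>- e\<close> with \<open>e = - 1\<close>.\<close>
  have "zs j * z j \<in> prods (- 1) (- (- 1))"
  proof (rule prods_of_q_commute[OF _ _ z_0_zs_0 c])
    show "zs 0 \<in> H (- 1)" "z 0 \<in> H (- (- 1))"
      using z_hom[of 0] zs_hom[of 0] degree_0 by simp_all
    show "zs j \<in> H (int (Suc N) * - 1)" "z j \<in> H (- (int (Suc N) * - 1))"
      using z_hom[OF assms(2)] zs_hom[OF assms(2)]
      by (simp_all only: N mult_minus_right mult_1_right minus_minus)
    show "z j * z 0 - scalar (of_real (1 / q)) * (z 0 * z j) \<in> I"
      by (rule z_z_0[OF assms])
  qed
  then show ?thesis by simp
qed

text \<open>Descending induction on \<open>j\<close>: modulo \<open>I\<close>,
  \<open>z j * zs j\<close> differs from \<open>zs j * z j\<close> by a multiple of the sum over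
  larger indices, which is empty for \<open>j = n\<close>.\<close>

lemma z_zs_in_prods':
  assumes "j \<le> n"
  shows "z j * zs j \<in> prods (- 1) 1"
  using assms
proof (induction "n - j" arbitrary: j rule: less_induct)
  case less
  have "zs j * z j \<in> prods (- 1) 1"
  proof (cases "j = 0")
    case True
    then show ?thesis
      using z_hom[of 0] zs_hom[of 0] degree_0 by (auto intro: prods.prod)
  next
    case False
    then show ?thesis by (intro zs_z_in_prods less.prems) simp
  qed
  moreover have "(\<Sum>i=j+1..n. z i * zs i) \<in> prods (- 1) 1"
    by (intro prods_sum less.hyps) auto
  ultimately show ?case
    by (intro prods_cong[OF z_zs_relation[OF less.prems]] prods.add prods_scalar)
qed

theorem strongly_graded_sphere: "strongly_graded A G"
proof (rule strongly_gradedI)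
  have one: "1 \<in> prods k l" if "\<And>j. j \<le> n \<Longrightarrow> z j * zs j \<in> prods k l" for k l
  proof -
    \<comment> \<open>This difference equals \<open>1\<close>: the sum lies in
      \<open>prods k l\<close> term by term, and the subtracted part lies in
      \<open>I\<close>.\<close>
    have "(\<Sum>j=0..n. z j * zs j) - ((\<Sum>j=0..n. z j * zs j) - 1) \<in> prods k l"
      by (intro prods_diff prods_sum prods.rel sphere_relation that) simp
    then show ?thesis by simp
  qed
  show "1 \<in> prods 1 (- 1)"
    by (rule one[OF z_zs_in_prods])
  show "1 \<in> prods (- 1) 1"
    by (rule one[OF z_zs_in_prods'])
qed

end

section \<open>Prolongated spheres and the two instances\<close>

text \<open>For \<open>zs n - w * z n\<close> the degree of \<open>w\<close> is decisive:
  \<open>- 2 * m n + m n = - m n\<close>. Commuting with \<open>w\<close> keeps the degree, and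
  \<open>w\<close> and \<open>ws\<close> have opposite degrees.\<close>

lemma prolongated_rels_homogeneous:
  "prolongated_rels q n \<subseteq> (\<Union>k. hom_polys (prolongated_gens n) (gen_degree n m) k)"
proof -
  let ?H = "hom_polys (prolongated_gens n) (gen_degree n m)"
  have w: "w \<in> ?H (gen_degree n m W)" "ws \<in> ?H (- gen_degree n m W)"
    by (auto simp: prolongated_gens_def intro!: hom_polys_gen hom_polys_adj simp del: gen_degree.simps)
  have z: "z i \<in> ?H (int (m i))" and zs: "zs i \<in> ?H (- int (m i))" if "i \<le> n" for i
    using hom_polys_gen[of "Z i" "prolongated_gens n" "gen_degree n m"]
      hom_polys_adj[of "Z i" "prolongated_gens n" "gen_degree n m"] that
    by (auto simp: prolongated_gens_def sphere_gens_def)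
  have w_comm: "w * r - r * w \<in> ?H (gen_degree n m W + k)" if "r \<in> ?H k" for r k
    using hom_polys_diff[OF hom_polys_mult[OF w(1) that]] hom_polys_mult[OF that w(1)]
    unfolding add.commute[of k] .
  have 1: "w * z i - z i * w \<in> ?H (gen_degree n m W + int (m i))" if "i \<le> n" for i
    by (rule w_comm[OF z[OF that]])
  have 2: "w * zs i - zs i * w \<in> ?H (gen_degree n m W + - int (m i))" if "i \<le> n" for i
    by (rule w_comm[OF zs[OF that]])
  have 3: "w * ws - 1 \<in> ?H 0" "ws * w - 1 \<in> ?H 0"
    using hom_polys_mult[OF w] hom_polys_mult[OF w(2) w(1)] by (auto intro: hom_polys_diff)
  have 4: "zs n - w * z n \<in> ?H (- int (m n))"
    using hom_polys_mult[OF w(1) z[of n]] zs[of n] by (auto intro: hom_polys_diff)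
  have 5: "sphere_rels q n \<subseteq> (\<Union>k. ?H k)"
    by (rule sphere_rels_homogeneous) (auto simp: prolongated_gens_def)
  show ?thesis
    unfolding prolongated_rels_def
    by (intro Un_least 5 subsetI; elim CollectE exE conjE insertE emptyE; hypsubst;
        rule UN_I[OF UNIV_I]; (rule 1 2 3 4; assumption))
qed

theorem theorem4p3:
  fixes q :: real and n :: nat and m :: "nat \<Rightarrow> nat"
  assumes "0 < q" and "q < 1"
    and "1 \<le> n"
    and "\<forall>i\<in>{1..n}. 0 < m i"
  shows "strongly_graded (quantum_sphere q n)
           (quantum_sphere_grading q n (unit_weights m)) \<and>
         strongly_graded (prolongated_sphere q n)
           (prolongated_sphere_grading q n (unit_weights m))"
proof
  \<comment> \<open>The weight at index \<open>0\<close> is \<open>1\<close> by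
    \<open>unit_weights\<close>; the others are positive by hypothesis.\<close>
  have pos: "0 < gen_degree n (unit_weights m) (Z i)" if "i \<le> n" for i
    using assms(4) that by (cases "i = 0") (auto simp: unit_weights_def)
  show "strongly_graded (quantum_sphere q n) (quantum_sphere_grading q n (unit_weights m))"
  proof -
    interpret weighted_sphere_presentation "sphere_gens n" "sphere_rels q n"
      "gen_degree n (unit_weights m)" q n
      using assms(1,2) pos by unfold_locales
        (simp_all add: sphere_rels_homogeneous, simp add: unit_weights_def)
    show ?thesis
      unfolding quantum_sphere_def quantum_sphere_grading_def by (rule strongly_graded_sphere)
  qed
  show "strongly_graded (prolongated_sphere q n) (prolongated_sphere_grading q n (unit_weights m))"
  proof -
    \<comment> \<open>The prolongated sphere keeps all generators and relations of the sphere, so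
      the same locale applies.\<close>
    interpret weighted_sphere_presentation "prolongated_gens n" "prolongated_rels q n"
      "gen_degree n (unit_weights m)" q n
      using assms(1,2) pos by unfold_locales
        (simp_all add: prolongated_rels_homogeneous, auto simp: unit_weights_def prolongated_gens_def prolongated_rels_def)
    show ?thesis
      unfolding prolongated_sphere_def prolongated_sphere_grading_def by (rule strongly_graded_sphere)
  qed
qed

end
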